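(* Let $X, Y \subseteq \omega$. Suppose $\mathcal{A}$ is a $Y$-computable combinatory algebra, and that $f:\mathcal{K}_1^X\hookrightarrow \mathcal{A}$ is a weak embedding. Then $X <_T Y$ (that is, $X \leq_T Y$ and $Y \not\leq_T X$).
   Context: A partial applicative structure (pas) is a set $\mathcal{A}$ with a partial binary operation $(a,b)\mapsto a\cdot b=ab$, called application, associating to the left; $ab\downarrow$ means that $ab$ is defined. Application is strict: a compound term $t_1t_2$ is defined only if $t_1$ and $t_2$ are both defined. For closed terms, $t\simeq s$ means that either both are undefined, or both are defined and equal. A pas is a partial combinatory algebra (pca) if it has elements $k,s$ (combinators) such that for all $a,b,c\in\mathcal{A}$: $ka\downarrow$ and $kab=a$; $sab\downarrow$ and $sabc\simeq ac(bc)$. (This is equivalent to combinatory completeness.) A combinatory algebra is a pca whose application is total. All pcas are assumed nontrivial, i.e. to have more than one element. $\mathcal{K}_1^X$ (Kleene's first model relativized to the oracle $X$) is the pca on $\omega$ with application $n\cdot m=\varphi^X_n(m)$, where $\varphi^X_n$ is the $n$-th partial $X$-computable function. A combinatory algebra $\mathcal{A}$ is $Y$-computable if there are a surjection (numbering) $\gamma:\omega\to\mathcal{A}$ and a total $Y$-computable function $\psi:\omega^2\to\omega$ such that $\gamma(n)\cdot\gamma(m)=\gamma(\psi(n,m))$ for all $n,m$, and such that the set $\{(n,m)\mid\gamma(n)=\gamma(m)\}$ is $Y$-computable. (No effectivity is required of $\gamma$ itself.) A weak embedding of a pca $\mathcal{A}$ into a pca $\mathcal{B}$ (written $\mathcal{A}\hookrightarrow\mathcal{B}$)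 is an injection $f:\mathcal{A}\to\mathcal{B}$ such that for all $a,b\in\mathcal{A}$, if $ab$ is defined in $\mathcal{A}$, then $f(a)f(b)$ is defined in $\mathcal{B}$ and equals $f(ab)$. *)

theory Defs
  imports Main "HOL-Library.Nat_Bijection"
begin

section \<open>Computability relative to an oracle\<close>

text \<open>
  Partial recursive functionals with a set oracle, presented as unary functions on the naturals;
  tuples are passed through the pairing bijection \<^const>\<open>prod_encode\<close>.
\<close>

datatype code =
    CZero | CSucc | CFst | CSnd | COracle
  | CPair code code | CComp code code | CPrec code code | CMu code

definition char_fun :: "nat set \<Rightarrow> nat \<Rightarrow> nat" where
  "char_fun X n = (if n \<in> X then 1 else 0)"

text \<open>
  \<open>CPrec c d\<close> denotes the function \<open>h\<close> with \<open>h(a, 0) = c(a)\<close> and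
  \<open>h(a, k+1) = d(a, (k, h(a, k)))\<close>; \<open>CMu c\<close> denotes unbounded search for the least \<open>k\<close> with
  \<open>c(n, k) = 0\<close>, all previous values being defined.
\<close>

primrec eval :: "nat set \<Rightarrow> code \<Rightarrow> nat \<Rightarrow> nat option" where
  "eval X CZero n = Some 0"
| "eval X CSucc n = Some (Suc n)"
| "eval X CFst n = Some (fst (prod_decode n))"
| "eval X CSnd n = Some (snd (prod_decode n))"
| "eval X COracle n = Some (char_fun X n)"
| "eval X (CPair c d) n =
     Option.bind (eval X c n) (\<lambda>u. Option.bind (eval X d n) (\<lambda>v. Some (prod_encode (u, v))))"
| "eval X (CComp c d) n = Option.bind (eval X d n) (eval X c)"
| "eval X (CPrec c d) n = (case prod_decode n of (a, k) \<Rightarrow>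
     rec_nat (eval X c a)
       (\<lambda>i r. Option.bind r (\<lambda>v. eval X d (prod_encode (a, prod_encode (i, v))))) k)"
| "eval X (CMu c) n =
     (if \<exists>k. eval X c (prod_encode (n, k)) = Some 0 \<and>
             (\<forall>j<k. eval X c (prod_encode (n, j)) \<noteq> None)
      then Some (LEAST k. eval X c (prod_encode (n, k)) = Some 0)
      else None)"

text \<open>
  An effective numbering of all codes: a number is read as a pair of a constructor tag and its
  arguments. Numbers with an unused tag also denote \<^const>\<open>CZero\<close>, so every number is an index.
\<close>

function decode :: "nat \<Rightarrow> code" where
  "decode e =
    (case prod_decode e of (t, r) \<Rightarrow> case prod_decode r of (a, b) \<Rightarrow>
       if t = 1 then CSucc
       else if t = 2 then CFst
       else if t = 3 then CSnd
       else if t = 4 then COracle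
       else if t = 5 then CPair (decode a) (decode b)
       else if t = 6 then CComp (decode a) (decode b)
       else if t = 7 then CPrec (decode a) (decode b)
       else if t = 8 then CMu (decode r)
       else CZero)"
  by pat_completeness auto

lemma prod_decode_less:
  assumes "prod_decode e = (t, r)" "t \<noteq> 0" "prod_decode r = (a, b)"
  shows "r < e" "a < e" "b < e"
proof -
  have e: "e = prod_encode (t, r)" and r: "r = prod_encode (a, b)"
    using assms by (metis prod_decode_inverse)+
  have "m \<le> triangle m" for m
    by (induction m) auto
  from this[of "t + r"] show "r < e"
    using assms(2) by (simp add: e prod_encode_def)
  then show "a < e" "b < e"
    using le_prod_encode_1[of a b] le_prod_encode_2[of b a] by (auto simp: r)
qed

termination decode
  by (relation "measure id") (auto dest: prod_decode_less[OF sym _ sym])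

declare decode.simps [simp del]

lemma surj_decode: "surj decode"
proof -
  have "\<exists>e. decode e = c" for c
  proof (induction c)
    case CZero
    show ?case by (rule exI[of _ "prod_encode (0, 0)"]) (simp add: decode.simps split: prod.split)
  next
    case CSucc
    show ?case by (rule exI[of _ "prod_encode (1, 0)"]) (simp add: decode.simps split: prod.split)
  next
    case CFst
    show ?case by (rule exI[of _ "prod_encode (2, 0)"]) (simp add: decode.simps split: prod.split)
  next
    case CSnd
    show ?case by (rule exI[of _ "prod_encode (3, 0)"]) (simp add: decode.simps split: prod.split)
  next
    case COracle
    show ?case by (rule exI[of _ "prod_encode (4, 0)"]) (simp add: decode.simps split: prod.split)
  next
    case (CPair c d)
    then obtain x y where "decode x = c" "decode y = d" by blast
    then show ?case
      by (intro exI[of _ "prod_encode (5, prod_encode (x, y))"])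
        (subst decode.simps, simp)
  next
    case (CComp c d)
    then obtain x y where "decode x = c" "decode y = d" by blast
    then show ?case
      by (intro exI[of _ "prod_encode (6, prod_encode (x, y))"])
        (subst decode.simps, simp)
  next
    case (CPrec c d)
    then obtain x y where "decode x = c" "decode y = d" by blast
    then show ?case
      by (intro exI[of _ "prod_encode (7, prod_encode (x, y))"])
        (subst decode.simps, simp)
  next
    case (CMu c)
    then obtain x where "decode x = c" by blast
    then show ?case
      by (intro exI[of _ "prod_encode (8, x)"])
        (subst decode.simps, simp split: prod.split)
  qed
  then show ?thesis by (metis surjI)
qed

definition phi :: "nat set \<Rightarrow> nat \<Rightarrow> nat \<Rightarrow> nat option" where
  "phi X n = eval X (decode n)"

definition computable_in :: "nat set \<Rightarrow> (nat \<Rightarrow> nat) \<Rightarrow> bool" where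
  "computable_in Y g \<longleftrightarrow> (\<exists>e. \<forall>n. phi Y e n = Some (g n))"

definition computable2_in :: "nat set \<Rightarrow> (nat \<Rightarrow> nat \<Rightarrow> nat) \<Rightarrow> bool" where
  "computable2_in Y g \<longleftrightarrow> computable_in Y (\<lambda>p. case prod_decode p of (n, m) \<Rightarrow> g n m)"

definition computable_set_in :: "nat set \<Rightarrow> nat set \<Rightarrow> bool" where
  "computable_set_in Y S \<longleftrightarrow> computable_in Y (char_fun S)"

definition computable_rel_in :: "nat set \<Rightarrow> (nat \<times> nat) set \<Rightarrow> bool" where
  "computable_rel_in Y R \<longleftrightarrow> computable_set_in Y (prod_encode ` R)"

definition turing_le :: "nat set \<Rightarrow> nat set \<Rightarrow> bool" (infix "\<le>\<^sub>T" 50) where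
  "X \<le>\<^sub>T Y \<longleftrightarrow> computable_set_in Y X"

definition turing_less :: "nat set \<Rightarrow> nat set \<Rightarrow> bool" (infix "<\<^sub>T" 50) where
  "X <\<^sub>T Y \<longleftrightarrow> X \<le>\<^sub>T Y \<and> \<not> Y \<le>\<^sub>T X"

section \<open>Partial combinatory algebras\<close>

text \<open>
  The carrier of a structure is its whole type. Terms are elements of the option type, with
  \<^const>\<open>None\<close> for an undefined term; hence plain equality of terms is the relation \<open>\<simeq>\<close>.
\<close>

locale pas =
  fixes app :: "'a \<Rightarrow> 'a \<Rightarrow> 'a option"
begin

definition term_app :: "'a option \<Rightarrow> 'a option \<Rightarrow> 'a option" (infixl "\<bullet>" 70) where
  "t \<bullet> u = Option.bind t (\<lambda>a. Option.bind u (\<lambda>b. app a b))"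

end

locale pca = pas app for app :: "'a \<Rightarrow> 'a \<Rightarrow> 'a option" +
  assumes nontrivial: "\<exists>a b :: 'a. a \<noteq> b"
    and combinators: "\<exists>k s.
      (\<forall>a b. Some k \<bullet> Some a \<noteq> None \<and> Some k \<bullet> Some a \<bullet> Some b = Some a) \<and>
      (\<forall>a b c. Some s \<bullet> Some a \<bullet> Some b \<noteq> None \<and>
         Some s \<bullet> Some a \<bullet> Some b \<bullet> Some c = Some a \<bullet> Some c \<bullet> (Some b \<bullet> Some c))"

locale combinatory_algebra = pca app for app :: "'a \<Rightarrow> 'a \<Rightarrow> 'a option" +
  assumes total: "app a b \<noteq> None"

definition kleene1 :: "nat set \<Rightarrow> nat \<Rightarrow> nat \<Rightarrow> nat option" where
  "kleene1 X n m = phi X n m"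

definition computable_combinatory_algebra ::
    "nat set \<Rightarrow> ('a \<Rightarrow> 'a \<Rightarrow> 'a option) \<Rightarrow> bool" where
  "computable_combinatory_algebra Y app \<longleftrightarrow>
     combinatory_algebra app \<and>
     (\<exists>(\<gamma> :: nat \<Rightarrow> 'a) \<psi>. surj \<gamma> \<and> computable2_in Y \<psi> \<and>
        (\<forall>n m. app (\<gamma> n) (\<gamma> m) = Some (\<gamma> (\<psi> n m))) \<and>
        computable_rel_in Y {(n, m). \<gamma> n = \<gamma> m})"

definition weak_embedding ::
    "('a \<Rightarrow> 'a \<Rightarrow> 'a option) \<Rightarrow> ('b \<Rightarrow> 'b \<Rightarrow> 'b option) \<Rightarrow> ('a \<Rightarrow> 'b) \<Rightarrow> bool" where
  "weak_embedding appA appB f \<longleftrightarrow>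
     inj f \<and> (\<forall>a b c. appA a b = Some c \<longrightarrow> appB (f a) (f b) = Some (f c))"

end

theory Submission
  imports Defs
begin

text \<open>
  Iterating the image of a successor index in the algebra yields a \<open>Y\<close>-computable function \<open>\<nu>\<close> such
  that \<open>\<nu> n\<close> is a name of \<open>f n\<close>. Applying the image of an index of the characteristic function of
  \<open>X\<close> to \<open>f n\<close> and comparing the result with \<open>f 1\<close> decides \<open>X\<close> from \<open>Y\<close>. As application in the
  algebra is total, the question whether \<open>f n\<close> applied to itself equals \<open>f 0\<close> is \<open>Y\<close>-decidable for
  all \<open>n\<close>. If \<open>Y \<le>\<^sub>T X\<close>, the corresponding characteristic function would have an index \<open>d\<close> in
  Kleene's first model relative to \<open>X\<close>, and \<open>f d\<close> applied to itself equals \<open>f 0\<close> iff it does not.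
\<close>

lemma computable_in_iff: "computable_in Y g \<longleftrightarrow> (\<exists>c. \<forall>n. eval Y c n = Some (g n))"
  unfolding computable_in_def phi_def by (metis surjD[OF surj_decode])

lemma computable_in_comp:
  assumes "computable_in Y g" "computable_in Y h"
  shows "computable_in Y (\<lambda>n. g (h n))"
proof -
  obtain c d where "\<forall>n. eval Y c n = Some (g n)" "\<forall>n. eval Y d n = Some (h n)"
    using assms unfolding computable_in_iff by blast
  then have "\<forall>n. eval Y (CComp c d) n = Some (g (h n))"
    by simp
  then show ?thesis
    unfolding computable_in_iff by blast
qed

lemma computable_in_pair:
  assumes "computable_in Y g" "computable_in Y h"
  shows "computable_in Y (\<lambda>n. prod_encode (g n, h n))"
proof -
  obtain c d where "\<forall>n. eval Y c n = Some (g n)" "\<forall>n. eval Y d n = Some (h n)"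
    using assms unfolding computable_in_iff by blast
  then have "\<forall>n. eval Y (CPair c d) n = Some (prod_encode (g n, h n))"
    by simp
  then show ?thesis
    unfolding computable_in_iff by blast
qed

lemma computable_in_Suc: "computable_in Y Suc"
  unfolding computable_in_iff by (rule exI[of _ CSucc]) simp

lemma computable_in_oracle: "computable_in Y (char_fun Y)"
  unfolding computable_in_iff by (rule exI[of _ COracle]) simp

lemma computable_in_snd: "computable_in Y (\<lambda>n. snd (prod_decode n))"
  unfolding computable_in_iff by (rule exI[of _ CSnd]) simp

lemma computable_in_id: "computable_in Y (\<lambda>n. n)"
  \<comment> \<open>No code is the identity outright, but re-pairing the two components of an
    argument returns it.\<close>
  unfolding computable_in_iff by (rule exI[of _ "CPair CFst CSnd"]) simp

lemma computable_in_const: "computable_in Y (\<lambda>_. a)"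
proof (induction a)
  case 0
  show ?case
    unfolding computable_in_iff by (rule exI[of _ CZero]) simp
next
  case (Suc a)
  show ?case
    using computable_in_comp[OF computable_in_Suc Suc] .
qed

text \<open>Iteration is primitive recursion whose step uses only the previous value, ignoring the
  parameter and the counter.\<close>

lemma computable_in_funpow:
  assumes "computable_in Y g"
  shows "computable_in Y (\<lambda>n. (g ^^ n) a)"
proof -
  obtain c where c: "\<And>n. eval Y c n = Some a"
    using computable_in_const unfolding computable_in_iff by blast
  have "computable_in Y (\<lambda>p. g (snd (prod_decode (snd (prod_decode p)))))"
    by (intro computable_in_comp[OF assms] computable_in_comp[OF computable_in_snd]
        computable_in_snd)
  then obtain d where d: "\<And>p. eval Y d p = Some (g (snd (prod_decode (snd (prod_decode p)))))"
    unfolding computable_in_iff by blast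
  have "eval Y (CPrec c d) (prod_encode (b, n)) = Some ((g ^^ n) a)" for b n
    by (induction n) (simp_all add: c d)
  then have "computable_in Y (\<lambda>p. (g ^^ snd (prod_decode p)) a)"
    unfolding computable_in_iff by (metis prod_decode_inverse surjective_pairing)
  \<comment> \<open>The parameter is irrelevant, so pairing \<open>n\<close> with itself supplies
    one.\<close>
  from computable_in_comp[OF this computable_in_pair[OF computable_in_id computable_in_id]]
  show ?thesis
    by simp
qed

lemma computable2_in_comp:
  assumes "computable2_in Y \<psi>" "computable_in Y g" "computable_in Y h"
  shows "computable_in Y (\<lambda>n. \<psi> (g n) (h n))"
  using computable_in_comp[OF assms(1)[unfolded computable2_in_def]
      computable_in_pair[OF assms(2,3)]]
  by simp

lemma computable_rel_in_comp:
  assumes "computable_rel_in Y R" "computable_in Y g" "computable_in Y h"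
  shows "computable_set_in Y {n. (g n, h n) \<in> R}"
proof -
  have "char_fun (prod_encode ` R) (prod_encode (g n, h n)) = char_fun {n. (g n, h n) \<in> R} n" for n
    by (auto simp: char_fun_def inj_image_mem_iff[OF inj_prod_encode])
  then show ?thesis
    using computable_in_comp[OF assms(1)[unfolded computable_rel_in_def computable_set_in_def]
        computable_in_pair[OF assms(2,3)]]
    by (simp add: computable_set_in_def)
qed

text \<open>Replacing each oracle query by a code that computes its answer makes
  \<open>Y\<close>-computations \<open>X\<close>-computations when \<open>Y\<close> is reducible to
  \<open>X\<close>.\<close>

primrec subst_oracle :: "code \<Rightarrow> code \<Rightarrow> code" where
  "subst_oracle o' CZero = CZero"
| "subst_oracle o' CSucc = CSucc"
| "subst_oracle o' CFst = CFst"
| "subst_oracle o' CSnd = CSnd"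
| "subst_oracle o' COracle = o'"
| "subst_oracle o' (CPair c d) = CPair (subst_oracle o' c) (subst_oracle o' d)"
| "subst_oracle o' (CComp c d) = CComp (subst_oracle o' c) (subst_oracle o' d)"
| "subst_oracle o' (CPrec c d) = CPrec (subst_oracle o' c) (subst_oracle o' d)"
| "subst_oracle o' (CMu c) = CMu (subst_oracle o' c)"

text \<open>An equality of functions is needed, since \<open>CComp\<close>, \<open>CPrec\<close> and
  \<open>CMu\<close> evaluate subcodes at other arguments.\<close>

lemma eval_subst_oracle:
  assumes "\<And>n. eval X o' n = Some (char_fun Y n)"
  shows "eval X (subst_oracle o' c) = eval Y c"
  by (induction c; rule ext) (simp_all add: assms)

lemma computable_in_trans:
  assumes "Y \<le>\<^sub>T X" "computable_in Y g"
  shows "computable_in X g"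
  using assms eval_subst_oracle unfolding turing_le_def computable_set_in_def computable_in_iff
  by metis

theorem theorem5p2:
  fixes X Y :: "nat set"
    and app :: "'a \<Rightarrow> 'a \<Rightarrow> 'a option"
    and f :: "nat \<Rightarrow> 'a"
  assumes "computable_combinatory_algebra Y app"
    and "weak_embedding (kleene1 X) app f"
  shows "X <\<^sub>T Y"
proof -
  obtain \<gamma> :: "nat \<Rightarrow> 'a" and \<psi> where \<gamma>: "surj \<gamma>" and \<psi>: "computable2_in Y \<psi>"
    and app: "\<And>n m. app (\<gamma> n) (\<gamma> m) = Some (\<gamma> (\<psi> n m))"
    and eq: "computable_rel_in Y {(n, m). \<gamma> n = \<gamma> m}"
    using assms(1) unfolding computable_combinatory_algebra_def by blast
  \<comment> \<open>This choice of names need not be effective: only \<open>name (f s)\<close> and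
    \<open>name (f 0)\<close> enter the algorithm, as constants.\<close>
  obtain name where name: "\<And>a. \<gamma> (name a) = a"
    using surjD[OF \<gamma>] by metis
  have f_eq: "f n = f m \<longleftrightarrow> n = m" for n m
    using assms(2) by (auto simp: weak_embedding_def inj_eq)
  \<comment> \<open>An index of \<open>g\<close> serves as \<open>d\<close>: the embedding preserves
    its applications, all of which are defined.\<close>
  have represent: "\<exists>d. \<forall>n. app (f d) (f n) = Some (f (g n))" if "computable_in X g" for g
    using that assms(2) unfolding weak_embedding_def kleene1_def computable_in_def by blast
  obtain s where s: "\<And>n. app (f s) (f n) = Some (f (Suc n))"
    using represent[OF computable_in_Suc] by blast
  define \<nu> where "\<nu> n = (\<psi> (name (f s)) ^^ n) (name (f 0))" for n
  have \<nu>_computable: "computable_in Y \<nu>"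
    unfolding \<nu>_def
    by (intro computable_in_funpow computable2_in_comp[OF \<psi>] computable_in_const computable_in_id)
  have \<nu>: "\<gamma> (\<nu> n) = f n" for n
  proof (induction n)
    case 0
    show ?case
      by (simp add: \<nu>_def name)
  next
    case (Suc n)
    have "app (f s) (f n) = Some (\<gamma> (\<nu> (Suc n)))"
      using app[of "name (f s)" "\<nu> n"] Suc by (simp add: \<nu>_def name)
    then show ?case
      by (simp add: s)
  qed
  \<comment> \<open>This holds even where the computation with index \<open>d\<close> diverges on
    \<open>n\<close>.\<close>
  have app_f: "app (f d) (f n) = Some (\<gamma> (\<psi> (\<nu> d) (\<nu> n)))" for d n
    using app[of "\<nu> d" "\<nu> n"] by (simp add: \<nu>)
  \<comment> \<open>The question becomes equality of two computable names. A constant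
    \<open>g\<close> will serve for deciding \<open>X\<close>, the identity for the diagonal
    set.\<close>
  have decide: "computable_set_in Y {n. app (f (g n)) (f n) = Some (f m)}"
    if "computable_in Y g" for g m
  proof -
    have "computable_in Y (\<lambda>n. \<psi> (\<nu> (g n)) (\<nu> n))"
      by (intro computable2_in_comp[OF \<psi>] computable_in_comp[OF \<nu>_computable] \<nu>_computable that)
    from computable_rel_in_comp[OF eq this computable_in_const[of _ "\<nu> m"]]
    show ?thesis
      by (simp add: app_f \<nu>)
  qed
  have "X \<le>\<^sub>T Y"
  proof -
    obtain x where "\<And>n. app (f x) (f n) = Some (f (char_fun X n))"
      using represent[OF computable_in_oracle] by blast
    then have "{n. app (f x) (f n) = Some (f 1)} = X"
      by (auto simp: f_eq char_fun_def split: if_splits)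
    then show ?thesis
      using decide[OF computable_in_const, of x 1] by (simp add: turing_le_def)
  qed
  moreover have "\<not> Y \<le>\<^sub>T X"
  proof
    assume "Y \<le>\<^sub>T X"
    define D where "D = {n. app (f n) (f n) = Some (f 0)}"
    have "computable_in X (char_fun D)"
      using computable_in_trans[OF \<open>Y \<le>\<^sub>T X\<close>] decide[OF computable_in_id, of 0]
      by (simp add: D_def computable_set_in_def)
    then obtain d where "\<And>n. app (f d) (f n) = Some (f (char_fun D n))"
      using represent by blast
    \<comment> \<open>Evaluate at \<open>n = d\<close>; injectivity of \<open>f\<close> turns
      equality with \<open>f 0\<close> into a zero of \<open>char_fun D\<close>.\<close>
    then have "d \<in> D \<longleftrightarrow> char_fun D d = 0"
      by (simp add: D_def f_eq)
    then show False
      by (simp add: char_fun_def split: if_splits)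
  qed
  ultimately show ?thesis
    by (simp add: turing_less_def)
qed

end
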